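(* Let $m,n$ be positive integers and let $F$ be a field whose characteristic is zero or coprime to $n$. Let $g(X)$ be a polynomial over $F$ with $\deg g(X)<n$, let $d=\deg\gcd\big(g(X),\,X^n-1\big)$ and $r=\min\{m,\,n-d\}$. Then $\operatorname{rank} M(g)_{m\times n}=r$ and the first $r$ rows of $M(g)_{m\times n}$ are linearly independent.
   Context: For a polynomial $g(X)=\sum_{j=0}^{n-1}g_jX^j$ over $F$ of degree less than $n$, the generalized circulant matrix $M(g)_{m\times n}$ is the $m\times n$ matrix over $F$ whose $i$-th row ($i=0,1,\dots,m-1$, rows counted from $0$) is $\mathcal S^i(g_0,g_1,\dots,g_{n-1})$, where $\mathcal S(a_0,a_1,\dots,a_{n-1})=(a_{n-1},a_0,\dots,a_{n-2})$ is the circular shift on $F^n$. Equivalently, its $(i,j)$ entry ($0\le i<m$, $0\le j<n$) is $g_{(j-i)\bmod n}$. Here $\gcd$ of polynomials is the greatest common divisor in $F[X]$ (with $\gcd(0,f)=f$). *)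

theory Defs
  imports
    "HOL-Computational_Algebra.Polynomial"
    "HOL-Computational_Algebra.Polynomial_Factorial"
    "Jordan_Normal_Form.DL_Rank"
begin

text \<open>
  The library's \<^const>\<open>gcd\<close> on polynomials needs the coefficient type to be of class
  \<^class>\<open>field_gcd\<close>, which is a field together with additional Euclidean structure.  To cover
  an arbitrary \<^class>\<open>field\<close>, the gcd is defined here by its universal property, normalized to
  be monic (or zero); \<open>poly_gcd_eq_gcd\<close> shows that it is the library's gcd whenever that exists.
\<close>

definition poly_gcd :: "'a::field poly \<Rightarrow> 'a poly \<Rightarrow> 'a poly" where
  "poly_gcd p q = (THE h. h dvd p \<and> h dvd q \<and> (\<forall>k. k dvd p \<longrightarrow> k dvd q \<longrightarrow> k dvd h) \<and>
                          (h = 0 \<or> lead_coeff h = 1))"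

lemma poly_gcd_unique:
  fixes p q h :: "'a::field poly"
  assumes "h dvd p" "h dvd q" "\<And>k. k dvd p \<Longrightarrow> k dvd q \<Longrightarrow> k dvd h"
    and "h = 0 \<or> lead_coeff h = 1"
  shows "poly_gcd p q = h"
  unfolding poly_gcd_def
proof (rule the_equality)
  show "h dvd p \<and> h dvd q \<and> (\<forall>k. k dvd p \<longrightarrow> k dvd q \<longrightarrow> k dvd h) \<and> (h = 0 \<or> lead_coeff h = 1)"
    using assms by blast
next
  fix l
  assume l: "l dvd p \<and> l dvd q \<and> (\<forall>k. k dvd p \<longrightarrow> k dvd q \<longrightarrow> k dvd l) \<and> (l = 0 \<or> lead_coeff l = 1)"
  hence "l dvd h" "h dvd l" using assms by blast+
  show "l = h"
  proof (cases "h = 0")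
    case True
    with \<open>h dvd l\<close> show ?thesis by simp
  next
    case False
    with \<open>l dvd h\<close> have "l \<noteq> 0" by auto
    with False l assms(4) have lc: "lead_coeff l = 1" "lead_coeff h = 1" by auto
    from \<open>l dvd h\<close> obtain c where c: "h = l * c" by (elim dvdE)
    have "c \<noteq> 0" using False c by auto
    have "degree h \<le> degree l" using \<open>h dvd l\<close> \<open>l \<noteq> 0\<close> by (rule dvd_imp_degree_le)
    hence "degree c = 0" using c \<open>l \<noteq> 0\<close> \<open>c \<noteq> 0\<close> by (simp add: degree_mult_eq)
    then obtain a where a: "c = [:a:]" by (rule degree_eq_zeroE)
    have "lead_coeff h = lead_coeff l * lead_coeff c" unfolding c by (rule lead_coeff_mult)
    hence "a = 1" using lc a by simp
    thus ?thesis using c a by simp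
  qed
qed

lemma poly_gcd_exists:
  fixes p q :: "'a::field poly"
  shows "\<exists>h. h dvd p \<and> h dvd q \<and> (\<forall>k. k dvd p \<longrightarrow> k dvd q \<longrightarrow> k dvd h) \<and> (h = 0 \<or> lead_coeff h = 1)"
proof -
  have "\<exists>h. h dvd p \<and> h dvd q \<and> (\<forall>k. k dvd p \<longrightarrow> k dvd q \<longrightarrow> k dvd h)"
  proof (induction "euclidean_size q" arbitrary: p q rule: less_induct)
    case less
    show ?case
    proof (cases "q = 0")
      case True
      thus ?thesis by (intro exI[of _ p]) auto
    next
      case False
      hence "euclidean_size (p mod q) < euclidean_size q" by (rule mod_size_less)
      from less[OF this] obtain h where
        h: "h dvd q" "h dvd p mod q" "\<And>k. k dvd q \<Longrightarrow> k dvd p mod q \<Longrightarrow> k dvd h" by blast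
      have "h dvd p" using h(1,2) by (rule dvd_mod_imp_dvd[rotated])
      moreover have "k dvd h" if "k dvd p" "k dvd q" for k
        using that by (intro h(3) dvd_mod)
      ultimately show ?thesis using h(1) by blast
    qed
  qed
  then obtain h where h: "h dvd p" "h dvd q" "\<And>k. k dvd p \<Longrightarrow> k dvd q \<Longrightarrow> k dvd h" by blast
  show ?thesis
  proof (cases "h = 0")
    case True
    thus ?thesis using h by blast
  next
    case False
    define c where "c = inverse (lead_coeff h)"
    have c: "c \<noteq> 0" "c * lead_coeff h = 1" using False by (simp_all add: c_def)
    have "Polynomial.smult c h dvd p" "Polynomial.smult c h dvd q" using h(1,2) c(1) by (simp_all add: smult_dvd)
    moreover have "k dvd Polynomial.smult c h" if "k dvd p" "k dvd q" for k
      using h(3)[OF that] by (rule dvd_smult)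
    moreover have "lead_coeff (Polynomial.smult c h) = 1" using c by simp
    ultimately show ?thesis by blast
  qed
qed

lemma
  fixes p q :: "'a::field poly"
  shows poly_gcd_dvd1: "poly_gcd p q dvd p"
    and poly_gcd_dvd2: "poly_gcd p q dvd q"
    and poly_gcd_greatest: "k dvd p \<Longrightarrow> k dvd q \<Longrightarrow> k dvd poly_gcd p q"
    and poly_gcd_monic: "poly_gcd p q = 0 \<or> lead_coeff (poly_gcd p q) = 1"
proof -
  obtain h where h: "h dvd p" "h dvd q" "\<And>k. k dvd p \<Longrightarrow> k dvd q \<Longrightarrow> k dvd h"
    "h = 0 \<or> lead_coeff h = 1" using poly_gcd_exists[of p q] by blast
  have eq: "poly_gcd p q = h" using h by (rule poly_gcd_unique)
  show "poly_gcd p q dvd p" "poly_gcd p q dvd q" "poly_gcd p q = 0 \<or> lead_coeff (poly_gcd p q) = 1"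
    unfolding eq by (fact h)+
  show "k dvd poly_gcd p q" if "k dvd p" "k dvd q"
    unfolding eq using that by (rule h(3))
qed

lemma poly_gcd_eq_gcd: "poly_gcd p q = gcd p (q :: 'a::field_gcd poly)"
proof (rule poly_gcd_unique)
  show "gcd p q = 0 \<or> lead_coeff (gcd p q) = 1"
  proof (cases "gcd p q = 0")
    case False
    hence "is_unit (lead_coeff (gcd p q))" by (simp add: dvd_field_iff)
    hence "unit_factor (lead_coeff (gcd p q)) = lead_coeff (gcd p q)"
      by (rule is_unit_unit_factor)
    moreover have "unit_factor (gcd p q) = 1" using False by (simp add: unit_factor_gcd)
    ultimately have "[:lead_coeff (gcd p q):] = 1" by (simp add: unit_factor_poly_def)
    thus ?thesis by (simp add: one_pCons)
  qed simp
qed auto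

definition circ_shift :: "'a vec \<Rightarrow> 'a vec" where
  "circ_shift v = vec (dim_vec v) (\<lambda>j. if j = 0 then v $ (dim_vec v - 1) else v $ (j - 1))"

definition gen_circulant :: "nat \<Rightarrow> nat \<Rightarrow> 'a::zero poly \<Rightarrow> 'a mat" where
  "gen_circulant m n g = mat_of_rows n (map (\<lambda>i. (circ_shift ^^ i) (vec n (coeff g))) [0..<m])"

lemma dim_circ_shift [simp]: "dim_vec (circ_shift v) = dim_vec v"
  by (simp add: circ_shift_def)

lemma circ_shift_index:
  "j < dim_vec v \<Longrightarrow> circ_shift v $ j = (if j = 0 then v $ (dim_vec v - 1) else v $ (j - 1))"
  by (simp add: circ_shift_def)

lemma gen_circulant_carrier: "gen_circulant m n g \<in> carrier_mat m n"
  by (simp add: gen_circulant_def mat_of_rows_def)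

lemma gen_circulant_index:
  assumes "i < m" "j < n"
  shows "gen_circulant m n g $$ (i, j) = coeff g (nat ((int j - int i) mod int n))"
proof -
  have dim: "dim_vec ((circ_shift ^^ k) (vec n (coeff g))) = n" for k
    by (induction k) simp_all
  have "(circ_shift ^^ k) (vec n (coeff g)) $ j = coeff g (nat ((int j - int k) mod int n))" for k
    using \<open>j < n\<close>
  proof (induction k arbitrary: j)
    case 0
    thus ?case by simp
  next
    case (Suc k)
    show ?case
    proof (cases "j = 0")
      case True
      have "(int (n - 1) - int k) mod int n = (int n + (int j - int (Suc k))) mod int n"
        using Suc.prems True by (simp add: of_nat_diff algebra_simps)
      also have "\<dots> = (int j - int (Suc k)) mod int n" by simp
      finally have "(int (n - 1) - int k) mod int n = (int j - int (Suc k)) mod int n" .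
      thus ?thesis using Suc.prems True Suc.IH[of "n - 1"] dim[of k] by (simp add: circ_shift_index)
    next
      case False
      hence eq: "int (j - 1) - int k = int j - int (Suc k)" by (simp add: of_nat_diff)
      have "j - 1 < n" using Suc.prems by simp
      note IH = Suc.IH[OF this, unfolded eq]
      show ?thesis using Suc.prems False IH dim[of k]
        by (simp add: circ_shift_index del: of_nat_Suc)
    qed
  qed
  thus ?thesis using assms by (simp add: gen_circulant_def mat_of_rows_def)
qed

text \<open>
  Linear independence of a list of vectors as a family: a repeated vector makes the list
  dependent, which set-based independence alone would not see.
\<close>

definition lin_indpt_family :: "nat \<Rightarrow> 'a::field vec list \<Rightarrow> bool" where
  "lin_indpt_family n vs \<longleftrightarrow> set vs \<subseteq> carrier_vec n \<and> distinct vs \<and>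
     module.lin_indpt class_ring (module_vec TYPE('a) n) (set vs)"

end

theory Submission
  imports Defs
begin

text \<open>
  Write \<open>M\<close> for \<open>X^n - 1\<close>.  The circular shift is multiplication by \<open>X\<close> modulo \<open>M\<close>, so row \<open>i\<close> of
  the circulant holds the coefficients of \<open>X^i g mod M\<close>, and the combination of the rows with
  coefficients \<open>c\<^sub>i\<close> holds those of \<open>c g mod M\<close>, where \<open>c = \<Sum>i. c\<^sub>i X^i\<close>
  (\<open>gen_circulant_row_combination\<close>).  Let \<open>h = gcd(g, M)\<close> and \<open>s = M / h\<close>, a polynomial of degree
  \<open>n - d\<close>.  By Bezout, \<open>M\<close> divides \<open>c g\<close> exactly if \<open>s\<close> divides \<open>c\<close>
  (\<open>dvd_mult_iff_cofactor_dvd\<close>); in other words, the linear relations between the rows are the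
  multiples of \<open>s\<close>.  This has two consequences.

  A nonzero multiple of \<open>s\<close> has degree at least \<open>n - d\<close>, so at most \<open>n - d\<close> initial rows admit no
  nontrivial relation (\<open>gen_circulant_rows_independent\<close>).  Conversely, \<open>X^i - (X^i mod s)\<close> is a
  relation, which expresses row \<open>i\<close> through the first \<open>n - d\<close> rows
  (\<open>gen_circulant_factorization\<close>).

  The rank is the dimension of the column space, while these two statements concern rows.  They are
  carried over by \<open>rank_mult_le\<close> for the upper bound and by \<open>card_independent_rows_le_rank\<close>, half
  of the equality of row rank and column rank, for the lower one.
\<close>

section \<open>Bounding the column rank through the rows\<close>

text \<open>
  Fewer than \<open>n\<close> homogeneous linear equations in \<open>n\<close> unknowns have a nontrivial solution: filled up
  with zero rows, the system has a square matrix of determinant zero.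
\<close>

lemma exists_nonzero_orthogonal:
  fixes vs :: "'a::field vec list"
  assumes "length vs < n" "set vs \<subseteq> carrier_vec n"
  obtains v where "v \<in> carrier_vec n" "v \<noteq> 0\<^sub>v n" "\<And>w. w \<in> set vs \<Longrightarrow> v \<bullet> w = 0"
proof -
  define c where "c i = (if i < length vs then vs ! i else 0\<^sub>v n)" for i
  define M where "M = mat\<^sub>r n n (\<lambda>i. if i = length vs then 0\<^sub>v n else c i)"
  have c: "c i \<in> carrier_vec n" for i
    using assms(2) by (auto simp: c_def)
  have M: "M \<in> carrier_mat n n" by (simp add: M_def)
  have "det M = 0"
    unfolding M_def using assms(1) c by (intro det_row_0) auto
  then obtain v where v: "v \<in> carrier_vec n" "v \<noteq> 0\<^sub>v n" "M *\<^sub>v v = 0\<^sub>v n"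
    using det_0_iff_vec_prod_zero_field[OF M] by blast
  have "v \<bullet> w = 0" if w_in: "w \<in> set vs" for w
  proof -
    obtain i where i: "i < length vs" "w = vs ! i" using w_in by (auto simp: in_set_conv_nth)
    have w: "w \<in> carrier_vec n" using w_in assms(2) by blast
    have "row M i = w"
      using i assms(1) w c[of i] by (simp add: M_def c_def row_mat_of_row_fun)
    moreover have "(M *\<^sub>v v) $ i = row M i \<bullet> v" using i assms(1) M by simp
    ultimately have "w \<bullet> v = 0" using v(3) i assms(1) by simp
    thus ?thesis using comm_scalar_prod[OF w v(1)] by simp
  qed
  with v that show thesis by blast
qed

text \<open>
  If the column space had a basis \<open>S\<close> with fewer than \<open>card I\<close> elements, then \<open>S\<close> and the unit
  vectors outside \<open>I\<close> would together be fewer than \<open>n\<close> vectors.  A nonzero vector orthogonal to all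
  of them is supported on \<open>I\<close> and orthogonal to every column, hence it is a nontrivial relation
  between the rows in \<open>I\<close>.
\<close>

lemma (in vec_space) card_independent_rows_le_rank:
  assumes A: "A \<in> carrier_mat n nc" and I: "I \<subseteq> {..<n}"
    and indpt: "\<And>c i. (\<And>j. j < nc \<Longrightarrow> (\<Sum>i\<in>I. c i * A $$ (i, j)) = 0) \<Longrightarrow> i \<in> I \<Longrightarrow> c i = 0"
  shows "card I \<le> rank A"
proof (rule ccontr)
  assume "\<not> card I \<le> rank A"
  have colsA: "set (cols A) \<subseteq> carrier_vec n" using A cols_dim by blast
  obtain S where "finite S" and S: "maximal S (\<lambda>T. T \<subseteq> set (cols A) \<and> lin_indpt T)"
    using maximal_exists_superset[of "set (cols A)" "\<lambda>T. T \<subseteq> set (cols A) \<and> lin_indpt T" "{}"]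
      finite_lin_indpt2[of "{}"] by auto
  have SA: "S \<subseteq> set (cols A)" and liS: "lin_indpt S" using S by (auto simp: maximal_def)
  have Sn: "S \<subseteq> carrier_vec n" using SA colsA by blast
  have span: "set (cols A) \<subseteq> span S"
  proof
    fix w assume w: "w \<in> set (cols A)"
    show "w \<in> span S"
    proof (rule ccontr)
      assume nw: "w \<notin> span S"
      hence "w \<notin> S" using span_mem[OF Sn] by blast
      moreover have "lin_indpt (S \<union> {w})"
        using lin_dep_iff_in_span[of S w] Sn liS w colsA nw \<open>w \<notin> S\<close> by auto
      ultimately show False using S w SA unfolding maximal_def
        by (metis Un_empty_right Un_insert_right insertI1 insert_subset subset_insertI)
    qed
  qed
  obtain ss where ss: "set ss = S" "distinct ss" using \<open>finite S\<close> finite_distinct_list by blast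
  define us :: "'a vec list" where "us = map (unit_vec n) (sorted_list_of_set ({..<n} - I))"
  have "finite I" using I finite_subset by blast
  have "rank A = length ss"
    using rank_card_indpt[OF A S] ss distinct_card by metis
  hence "length (ss @ us) < n"
    using \<open>\<not> card I \<le> rank A\<close> I card_mono[OF _ I] \<open>finite I\<close>
    by (simp add: us_def card_Diff_subset)
  moreover have "set (ss @ us) \<subseteq> carrier_vec n" using ss Sn by (auto simp: us_def)
  ultimately obtain v where v: "v \<in> carrier_vec n" "v \<noteq> 0\<^sub>v n"
    "\<And>w. w \<in> set (ss @ us) \<Longrightarrow> v \<bullet> w = 0" using exists_nonzero_orthogonal by blast
  have supp: "v $ i = 0" if "i < n" "i \<notin> I" for i
    using v(3)[of "unit_vec n i"] v(1) that by (simp add: us_def)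
  have "v \<in> orthogonal_complement S" using v ss by (auto simp: orthogonal_complement_def)
  hence "v \<in> orthogonal_complement (span S)" by (simp add: Sn)
  hence orth: "v \<bullet> w = 0" if "w \<in> set (cols A)" for w
    using that span by (auto simp: orthogonal_complement_def)
  have "v $ i = 0" if "i \<in> I" for i
  proof (rule indpt[OF _ that])
    fix j assume j: "j < nc"
    have "(\<Sum>i\<in>I. v $ i * A $$ (i, j)) = (\<Sum>i<n. v $ i * A $$ (i, j))"
      using I supp by (intro sum.mono_neutral_left) auto
    also have "\<dots> = v \<bullet> col A j"
      using A j by (simp add: scalar_prod_def atLeast0LessThan)
    also have "\<dots> = 0" using A j by (intro orth) (auto simp: cols_def)
    finally show "(\<Sum>i\<in>I. v $ i * A $$ (i, j)) = 0" .
  qed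
  hence "v $ i = 0" if "i < n" for i using supp that by blast
  hence "v = 0\<^sub>v n" using v(1) by auto
  thus False using v(2) by blast
qed

text \<open>The columns of \<open>L * B\<close> lie in the span of the \<open>r\<close> columns of \<open>L\<close>.\<close>

lemma (in vec_space) rank_mult_le:
  assumes L: "L \<in> carrier_mat n r" and B: "B \<in> carrier_mat r nc"
  shows "rank (L * B) \<le> r"
proof -
  let ?W = "span (set (cols L))" and ?U = "span (set (cols (L * B)))"
  have LB: "L * B \<in> carrier_mat n nc" using L B by simp
  have cL: "set (cols L) \<subseteq> carrier_vec n" using L cols_dim by blast
  have cLB: "set (cols (L * B)) \<subseteq> carrier_vec n" using LB cols_dim by blast
  have "set (cols (L * B)) \<subseteq> ?W"
  proof
    fix w assume "w \<in> set (cols (L * B))"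
    then obtain j where j: "j < nc" "w = col (L * B) j" using LB by (auto simp: cols_def)
    hence "w = L *\<^sub>v col B j" using L B by (intro eq_vecI) auto
    moreover have "col B j \<in> carrier_vec r" using B by auto
    ultimately have "w \<in> col_space L" using L unfolding col_space_eq[OF L] by auto
    thus "w \<in> ?W" by (simp add: col_space_def)
  qed
  hence UW: "?U \<subseteq> ?W" using span_subsetI[OF cL] by blast
  have subW: "subspace class_ring ?W V" and subU: "subspace class_ring ?U V"
    using cL cLB span_is_subspace by auto
  have "rank (L * B) \<le> rank L"
    unfolding rank_def
    using vectorspace.subspace_dim[OF subspace_is_vs[OF subW] nested_subspaces[OF subW subU UW]
        fin_dim_span_cols[OF L]] fin_dim_span_cols[OF LB] by simp
  also have "\<dots> \<le> r" using rank_le_nc[OF L] .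
  finally show ?thesis .
qed

text \<open>
  This turns independence of a family into a statement about scalar sums indexed by position.
  Triviality of all such relations also excludes repetitions, since two equal members have
  difference zero.
\<close>

lemma lin_indpt_familyI:
  fixes vs :: "'a::field vec list"
  assumes vs: "set vs \<subseteq> carrier_vec n"
    and indpt: "\<And>c i. (\<And>j. j < n \<Longrightarrow> (\<Sum>i<length vs. c i * vs ! i $ j) = 0) \<Longrightarrow>
                  i < length vs \<Longrightarrow> c i = 0"
  shows "lin_indpt_family n vs"
proof -
  interpret vec_space "TYPE('a)" n .
  have dist: "distinct vs"
  proof (rule ccontr)
    assume "\<not> distinct vs"
    then obtain i k where ik: "i < length vs" "k < length vs" "i \<noteq> k" "vs ! i = vs ! k"
      by (auto simp: distinct_conv_nth)
    define c :: "nat \<Rightarrow> 'a" where "c l = of_bool (l = i) - of_bool (l = k)" for l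
    have "c i = 0"
    proof (rule indpt[OF _ ik(1)])
      fix j assume "j < n"
      have "(\<Sum>l<length vs. c l * vs ! l $ j) =
        (\<Sum>l<length vs. if l = i then vs ! l $ j else 0) - (\<Sum>l<length vs. if l = k then vs ! l $ j else 0)"
        unfolding sum_subtractf[symmetric] by (intro sum.cong) (auto simp: c_def)
      thus "(\<Sum>l<length vs. c l * vs ! l $ j) = 0" using ik by simp
    qed
    thus False using ik(3) by (simp add: c_def)
  qed
  have "lin_indpt (set vs)"
  proof
    assume dep: "lin_dep (set vs)"
    let ?A = "mat_of_cols n vs"
    have cols: "cols ?A = vs" using vs by simp
    obtain v where v: "v \<in> carrier_vec (length vs)" "v \<noteq> 0\<^sub>v (length vs)" "?A *\<^sub>v v = 0\<^sub>v n"
      using lin_depE[of ?A "length vs"] dep dist cols by (metis mat_of_cols_carrier(1))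
    have "v $ i = 0" if "i < length vs" for i
    proof (rule indpt[OF _ that])
      fix j assume j: "j < n"
      have "(?A *\<^sub>v v) $ j = (\<Sum>i<length vs. v $ i * vs ! i $ j)"
        using v(1) j by (simp add: scalar_prod_def atLeast0LessThan mat_of_cols_def mult.commute)
      thus "(\<Sum>i<length vs. v $ i * vs ! i $ j) = 0" using v(3) j by simp
    qed
    thus False using v(1,2) by (metis carrier_vecD eq_vecI index_zero_vec)
  qed
  thus ?thesis using vs dist by (simp add: lin_indpt_family_def)
qed

section \<open>Which multiples of a polynomial vanish modulo another\<close>

text \<open>
  The Euclidean algorithm yields some common divisor that is a combination of \<open>p\<close> and \<open>q\<close>; it
  divides the greatest common divisor, which is therefore a combination too.
\<close>

lemma poly_gcd_bezout:
  fixes p q :: "'a::field poly"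
  obtains a b where "poly_gcd p q = a * p + b * q"
proof -
  have "\<exists>h a b. h dvd p \<and> h dvd q \<and> h = a * p + b * q"
  proof (induction "euclidean_size q" arbitrary: p q rule: less_induct)
    case less
    show ?case
    proof (cases "q = 0")
      case True
      thus ?thesis by (intro exI[of _ p] exI[of _ 1] exI[of _ 0]) auto
    next
      case False
      hence "euclidean_size (p mod q) < euclidean_size q" by (rule mod_size_less)
      from less[OF this] obtain h a b where
        h: "h dvd q" "h dvd p mod q" "h = a * q + b * (p mod q)" by blast
      have "h dvd p" using h(1,2) by (rule dvd_mod_imp_dvd[rotated])
      moreover have "h = b * p + (a - b * (p div q)) * q"
        unfolding minus_div_mult_eq_mod[symmetric] h(3)
        by (simp add: algebra_simps minus_div_mult_eq_mod[symmetric])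
      ultimately show ?thesis using h(1) by blast
    qed
  qed
  then obtain h a b where h: "h dvd p" "h dvd q" "h = a * p + b * q" by blast
  from h(1,2) have "h dvd poly_gcd p q" by (rule poly_gcd_greatest)
  then obtain k where "poly_gcd p q = h * k" by (elim dvdE)
  hence "poly_gcd p q = (k * a) * p + (k * b) * q" using h(3) by (simp add: algebra_simps)
  thus thesis by (rule that)
qed

text \<open>
  With Bezout coefficients, \<open>c gcd(p, q) = a (c p) + b c q\<close>, so \<open>q = s gcd(p, q)\<close> divides
  \<open>c gcd(p, q)\<close> as soon as it divides \<open>c p\<close>, and the common factor cancels.
\<close>

lemma dvd_mult_iff_cofactor_dvd:
  fixes p q :: "'a::field poly"
  assumes "q \<noteq> 0" and s: "q = s * poly_gcd p q"
  shows "q dvd c * p \<longleftrightarrow> s dvd c"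
proof
  assume "q dvd c * p"
  obtain a b where ab: "poly_gcd p q = a * p + b * q" by (rule poly_gcd_bezout)
  have "c * poly_gcd p q = a * (c * p) + (c * b) * q" by (simp add: ab algebra_simps)
  hence "q dvd c * poly_gcd p q" using \<open>q dvd c * p\<close> by simp
  hence "s * poly_gcd p q dvd c * poly_gcd p q" using s by simp
  moreover have "poly_gcd p q \<noteq> 0" using assms by auto
  ultimately show "s dvd c" by simp
next
  assume "s dvd c"
  hence "s * poly_gcd p q dvd c * p" using poly_gcd_dvd1 by (rule mult_dvd_mono)
  thus "q dvd c * p" using s by simp
qed

section \<open>Circulant rows as residues modulo \<open>X^n - 1\<close>\<close>

lemma degree_monom_minus_1:
  assumes "n > 0"
  shows "degree (monom 1 n - 1 :: 'a::field poly) = n"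
proof (rule antisym)
  show "degree (monom 1 n - 1 :: 'a poly) \<le> n"
    by (rule degree_diff_le) (auto intro: degree_monom_le)
  show "n \<le> degree (monom 1 n - 1 :: 'a poly)"
    using assms by (intro le_degree) simp
qed

lemma monom_minus_1_nonzero:
  assumes "n > 0"
  shows "monom 1 n - 1 \<noteq> (0 :: 'a::field poly)"
  using degree_monom_minus_1[OF assms, where ?'a = 'a] assms by (metis degree_0 less_irrefl)

lemma degree_mod_monom_minus_1:
  fixes p :: "'a::field poly"
  assumes "n > 0"
  shows "degree (p mod (monom 1 n - 1)) < n"
  using degree_mod_less[OF monom_minus_1_nonzero[OF assms], of p]
    degree_monom_minus_1[OF assms, where ?'a = 'a] assms by (metis degree_0)

lemma cofactor_of_gcd:
  fixes g :: "'a::field poly"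
  assumes "n > 0"
  obtains s where "monom 1 n - 1 = s * poly_gcd g (monom 1 n - 1)" "s \<noteq> 0"
    "degree s = n - degree (poly_gcd g (monom 1 n - 1))"
proof -
  let ?M = "monom 1 n - 1 :: 'a poly"
  obtain s where s: "?M = s * poly_gcd g ?M"
    using poly_gcd_dvd2[of g ?M] by (metis dvdE mult.commute)
  have s0: "s \<noteq> 0" "poly_gcd g ?M \<noteq> 0"
    using monom_minus_1_nonzero[OF assms, where ?'a = 'a] s by auto
  hence "n = degree s + degree (poly_gcd g ?M)"
    using degree_monom_minus_1[OF assms, where ?'a = 'a] s degree_mult_eq by metis
  with that[OF s s0(1)] show thesis by simp
qed

text \<open>
  Multiplication by \<open>X\<close> moves every coefficient up by one place; the only term that can reach
  degree \<open>n\<close> is the top one, and reduction by \<open>X^n = 1\<close> returns it to the constant term.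
\<close>

lemma circ_shift_coeffs:
  fixes p :: "'a::field poly"
  assumes "n > 0" "degree p < n"
  shows "circ_shift (vec n (coeff p)) = vec n (coeff (pCons 0 p mod (monom 1 n - 1)))"
proof -
  let ?M = "monom 1 n - 1 :: 'a poly"
  let ?a = "coeff p (n - 1)"
  \<comment> \<open>the remainder: subtracting \<open>?a * (X^n - 1)\<close> cancels the term of degree \<open>n\<close>\<close>
  define R where "R = pCons 0 p - Polynomial.smult ?a ?M"
  have "coeff R k = 0" if "k \<ge> n" for k
  proof (cases "k = n")
    case True
    thus ?thesis using assms(1) by (simp add: R_def coeff_pCons split: nat.splits)
  next
    case False
    hence "k - 1 > degree p" using that assms by linarith
    thus ?thesis using that False assms(1) 
      by (auto simp add: R_def coeff_pCons coeff_eq_0 split: nat.splits)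
  qed
  hence "degree R \<le> n - 1" using assms(1) by (intro degree_le) auto
  hence "R mod ?M = R"
    using assms(1) degree_monom_minus_1[OF assms(1), where ?'a = 'a] by (intro mod_poly_less) simp
  moreover have "pCons 0 p = R + [:?a:] * ?M" by (simp add: R_def)
  ultimately have "pCons 0 p mod ?M = R" by (metis mod_mult_self1)
  thus ?thesis
    using assms by (intro eq_vecI)
      (auto simp: circ_shift_index R_def coeff_pCons split: nat.splits)
qed

lemma circ_shift_funpow_coeffs:
  fixes g :: "'a::field poly"
  assumes "n > 0" "degree g < n"
  shows "(circ_shift ^^ i) (vec n (coeff g)) = vec n (coeff (monom 1 i * g mod (monom 1 n - 1)))"
proof (induction i)
  case 0
  have "g mod (monom 1 n - 1) = g"
    using assms degree_monom_minus_1[of n, where ?'a = 'a] by (intro mod_poly_less) simp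
  thus ?case by simp
next
  case (Suc i)
  let ?p = "monom 1 i * g" and ?M = "monom 1 n - 1 :: 'a poly"
  have "pCons 0 (?p mod ?M) mod ?M = ([:0, 1:] * (?p mod ?M)) mod ?M" by simp
  also have "\<dots> = ([:0, 1:] * ?p) mod ?M" by (rule mod_mult_right_eq)
  also have "[:0, 1:] * ?p = monom 1 (Suc i) * g" by (simp add: monom_Suc)
  finally show ?case
    using Suc circ_shift_coeffs[OF assms(1) degree_mod_monom_minus_1[OF assms(1)], of ?p] by simp
qed

lemma gen_circulant_entry:
  fixes g :: "'a::field poly"
  assumes "n > 0" "degree g < n" "i < m" "j < n"
  shows "gen_circulant m n g $$ (i, j) = coeff (monom 1 i * g mod (monom 1 n - 1)) j"
  using assms circ_shift_funpow_coeffs[OF assms(1,2), of i]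
  by (simp add: gen_circulant_def mat_of_rows_def)

lemma gen_circulant_row_combination:
  fixes g :: "'a::field poly"
  assumes "n > 0" "degree g < n" "r \<le> m" "j < n"
  shows "(\<Sum>i<r. c i * gen_circulant m n g $$ (i, j)) =
         coeff ((\<Sum>i<r. monom (c i) i) * g mod (monom 1 n - 1)) j"
proof -
  let ?M = "monom 1 n - 1 :: 'a poly"
  have "coeff ((\<Sum>i<r. monom (c i) i) * g mod ?M) j = (\<Sum>i<r. c i * coeff (monom 1 i * g mod ?M) j)"
  proof (induction r)
    case (Suc r)
    have "monom (c r) r * g = Polynomial.smult (c r) (monom 1 r * g)"
      by (simp add: smult_monom flip: mult_smult_left)
    thus ?case using Suc by (simp add: distrib_right poly_mod_add_left mod_smult_left)
  qed simp
  also have "\<dots> = (\<Sum>i<r. c i * gen_circulant m n g $$ (i, j))"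
    using assms by (intro sum.cong) (auto simp: gen_circulant_entry)
  finally show ?thesis ..
qed

section \<open>Relations between the rows of a circulant\<close>

text \<open>
  A vanishing combination of the rows means that \<open>X^n - 1\<close> divides \<open>?C * g\<close>, so that the cofactor
  \<open>s\<close> divides \<open>?C\<close>; but \<open>?C\<close> has degree less than \<open>r \<le> degree s\<close>, so it is zero.
\<close>

lemma gen_circulant_rows_independent:
  fixes g :: "'a::field poly"
  assumes n: "n > 0" and g: "degree g < n" and r: "r \<le> m"
    "r \<le> n - degree (poly_gcd g (monom 1 n - 1))"
    and zero: "\<And>j. j < n \<Longrightarrow> (\<Sum>i<r. c i * gen_circulant m n g $$ (i, j)) = 0"
    and i: "i < r"
  shows "c i = 0"
proof -
  let ?M = "monom 1 n - 1 :: 'a poly"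
  let ?C = "\<Sum>i<r. monom (c i) i"
  obtain s where s: "?M = s * poly_gcd g ?M" "s \<noteq> 0"
    and deg_s: "degree s = n - degree (poly_gcd g ?M)" by (rule cofactor_of_gcd[OF n])
  have M: "?M \<noteq> 0" using n by (rule monom_minus_1_nonzero)
  have "?C * g mod ?M = 0"
  proof (rule poly_eqI)
    fix j
    show "coeff (?C * g mod ?M) j = coeff 0 j"
    proof (cases "j < n")
      case True
      thus ?thesis using zero[OF True] gen_circulant_row_combination[OF n g r(1) True] by simp
    next
      case False
      thus ?thesis using degree_mod_monom_minus_1[OF n, of "?C * g"] by (simp add: coeff_eq_0)
    qed
  qed
  hence "s dvd ?C"
    using dvd_mult_iff_cofactor_dvd[OF M s(1)] by (simp add: mod_eq_0_iff_dvd)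
  have coeff_C: "coeff ?C k = (if k < r then c k else 0)" for k
    by (simp add: coeff_sum)
  have "?C = 0"
  proof (rule ccontr)
    assume "?C \<noteq> 0"
    hence "coeff ?C (degree ?C) \<noteq> 0" by simp
    hence "degree ?C < r" using coeff_C by metis
    moreover have "degree s \<le> degree ?C"
      using \<open>s dvd ?C\<close> \<open>?C \<noteq> 0\<close> by (rule dvd_imp_degree_le)
    ultimately show False using deg_s r(2) by simp
  qed
  thus "c i = 0" using coeff_C[of i] i by simp
qed

text \<open>
  Row \<open>i\<close> of \<open>L\<close> holds the coefficients of \<open>X^i mod s\<close>.  Since \<open>s\<close> divides \<open>X^i - (X^i mod s)\<close>,
  the products of \<open>X^i\<close> and of \<open>X^i mod s\<close> with \<open>g\<close> agree modulo \<open>X^n - 1\<close>.  The case \<open>k = 0\<close>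
  occurs precisely for \<open>g = 0\<close>.
\<close>

lemma gen_circulant_factorization:
  fixes g :: "'a::field poly"
  assumes n: "n > 0" and g: "degree g < n"
    and k: "k = n - degree (poly_gcd g (monom 1 n - 1))" "k \<le> m"
  obtains L where "L \<in> carrier_mat m k" "gen_circulant m n g = L * gen_circulant k n g"
proof -
  let ?M = "monom 1 n - 1 :: 'a poly"
  obtain s where s: "?M = s * poly_gcd g ?M" "s \<noteq> 0"
    and deg_s: "degree s = n - degree (poly_gcd g ?M)" by (rule cofactor_of_gcd[OF n])
  have M: "?M \<noteq> 0" using n by (rule monom_minus_1_nonzero)
  define L where "L = mat m k (\<lambda>(i, l). coeff (monom 1 i mod s) l)"
  have L: "L \<in> carrier_mat m k" by (simp add: L_def)
  have B: "gen_circulant k n g \<in> carrier_mat k n" by (rule gen_circulant_carrier)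
  have A: "gen_circulant m n g \<in> carrier_mat m n" by (rule gen_circulant_carrier)
  have entry: "gen_circulant m n g $$ (i, j) = (L * gen_circulant k n g) $$ (i, j)"
    if i: "i < m" and j: "j < n" for i j
  proof -
    define t where "t = monom 1 i mod s"
    have t: "(\<Sum>l<k. monom (coeff t l) l) = t"
    proof (rule poly_eqI)
      fix l
      have "coeff t l = 0" if "l \<ge> k"
        using degree_mod_less[OF s(2), of "monom 1 i"] that deg_s k(1)
        by (auto simp: t_def coeff_eq_0)
      thus "coeff (\<Sum>l<k. monom (coeff t l) l) l = coeff t l"
        by (simp add: coeff_sum)
    qed
    have "s dvd monom 1 i - t" unfolding t_def by (simp add: dvd_minus_mod)
    hence "?M dvd (monom 1 i - t) * g" using dvd_mult_iff_cofactor_dvd[OF M s(1)] by blast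
    hence "monom 1 i * g mod ?M = t * g mod ?M"
      by (simp add: mod_eq_dvd_iff algebra_simps)
    hence "gen_circulant m n g $$ (i, j) = (\<Sum>l<k. coeff t l * gen_circulant k n g $$ (l, j))"
      using gen_circulant_entry[OF n g i j] 
        gen_circulant_row_combination[OF n g order_refl j, where c = "coeff t"] t by simp
    also have "\<dots> = (L * gen_circulant k n g) $$ (i, j)"
      using i j L B by (simp add: scalar_prod_def atLeast0LessThan L_def t_def)
    finally show ?thesis .
  qed
  have "gen_circulant m n g = L * gen_circulant k n g"
    using A B L entry by (intro eq_matI) auto
  with L that show thesis by blast
qed

section \<open>The rank of a generalized circulant\<close>

theorem theorem2p4:
  fixes m n d r :: nat and g :: "'a::field poly"
  assumes "m > 0" and "n > 0"
    and "CHAR('a) = 0 \<or> coprime CHAR('a) n"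
    and "degree g < n"
    and "d = degree (poly_gcd g (monom 1 n - 1))"
    and "r = min m (n - d)"
  shows "vec_space.rank m (gen_circulant m n g) = r
    \<and> lin_indpt_family n (take r (rows (gen_circulant m n g)))"
proof
  let ?A = "gen_circulant m n g"
  have A: "?A \<in> carrier_mat m n" by (rule gen_circulant_carrier)
  have r: "r \<le> m" "r \<le> n - degree (poly_gcd g (monom 1 n - 1))" using assms(5,6) by auto
  note indpt = gen_circulant_rows_independent[OF assms(2,4) r]
  interpret vec_space "TYPE('a)" m .
  show "rank ?A = r"
  proof (rule antisym)
    show "rank ?A \<le> r"
    proof (cases "n - d \<le> m")
      case True
      hence "r = n - degree (poly_gcd g (monom 1 n - 1))" using assms(5,6) by simp
      from gen_circulant_factorization[OF assms(2,4) this r(1)]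
      obtain L where "L \<in> carrier_mat m r" "?A = L * gen_circulant r n g" .
      thus ?thesis using rank_mult_le gen_circulant_carrier by metis
    next
      case False
      (* there are too few rows for a relation; the trivial factorization bounds the rank by m *)
      hence "r = m" using assms(6) by simp
      thus ?thesis using rank_mult_le[of "1\<^sub>m m" m ?A n] A by simp
    qed
    have "card {..<r} \<le> rank ?A"
      using r(1) indpt by (intro card_independent_rows_le_rank[OF A]) auto
    thus "r \<le> rank ?A" by simp
  qed
  have len: "length (take r (rows ?A)) = r" using A r(1) by simp
  have entry: "take r (rows ?A) ! i $ j = ?A $$ (i, j)" if "i < r" "j < n" for i j
    using that A r(1) by simp
  show "lin_indpt_family n (take r (rows ?A))"
  proof (rule lin_indpt_familyI)
    show "set (take r (rows ?A)) \<subseteq> carrier_vec n"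
      using A rows_carrier[of ?A] set_take_subset[of r "rows ?A"] by auto
  next
    fix c i
    assume zero: "\<And>j. j < n \<Longrightarrow> (\<Sum>i<length (take r (rows ?A)). c i * take r (rows ?A) ! i $ j) = 0"
      and i: "i < length (take r (rows ?A))"
    have "(\<Sum>i<r. c i * ?A $$ (i, j)) = 0" if "j < n" for j
      using zero[OF that] entry[OF _ that] unfolding len by simp
    thus "c i = 0" using indpt i unfolding len by blast
  qed
qed

end
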